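(* Let $G$ be a finite group, let $\theta:G\to G$ be an involution, and let $H\subset G$ be a $\theta$-stable subgroup (i.e. $\theta(H)=H$). Assume that for every $x\in G$ there exists $g\in G$ such that $gx^{-1}g^{-1}=\theta(x)$. Then the following are equivalent: (1) $(G,H)$ is a Gelfand pair. (2) For every $x\in G$ there exist $h_1,h_2\in H$ such that $h_1x^{-1}h_2=\theta(x)$.
   Context: All representations are finite-dimensional complex representations. An involution $\theta:G\to G$ is a group automorphism with $\theta\circ\theta=\mathrm{id}_G$. For a representation $\pi$ of $G$, $\pi^H$ denotes the subspace of $H$-invariant vectors. $(G,H)$ is a Gelfand pair if $\dim \pi^H\le 1$ for every irreducible representation $\pi$ of $G$. *)

theory Defs
  imports "Jordan_Normal_Form.VS_Connect"
begin

text \<open>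
  A finite-dimensional complex representation is a homomorphism into
  \<open>GL(n, \<complex>)\<close>, acting on \<open>\<complex>\<^sup>n\<close>, for an arbitrary dimension \<open>n\<close>.  Up to a choice of
  basis this covers all finite-dimensional complex representations, and it allows
  quantification over all of them inside a formula.
\<close>

definition GL_complex :: "nat \<Rightarrow> complex mat monoid" where
  "GL_complex n = units_of (ring_mat TYPE(complex) n ())"

definition representation :: "('g, 'b) monoid_scheme \<Rightarrow> nat \<Rightarrow> ('g \<Rightarrow> complex mat) \<Rightarrow> bool" where
  "representation G n \<pi> \<longleftrightarrow> \<pi> \<in> hom G (GL_complex n)"

definition invariant_subspace ::
  "('g, 'b) monoid_scheme \<Rightarrow> nat \<Rightarrow> ('g \<Rightarrow> complex mat) \<Rightarrow> complex vec set \<Rightarrow> bool" where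
  "invariant_subspace G n \<pi> W \<longleftrightarrow>
     VectorSpace.subspace class_ring W (module_vec TYPE(complex) n) \<and>
     (\<forall>g \<in> carrier G. \<forall>w \<in> W. \<pi> g *\<^sub>v w \<in> W)"

text \<open>The zero representation is not irreducible.\<close>

definition irreducible_representation ::
  "('g, 'b) monoid_scheme \<Rightarrow> nat \<Rightarrow> ('g \<Rightarrow> complex mat) \<Rightarrow> bool" where
  "irreducible_representation G n \<pi> \<longleftrightarrow>
     representation G n \<pi> \<and> n > 0 \<and>
     (\<forall>W. invariant_subspace G n \<pi> W \<longrightarrow> W = {0\<^sub>v n} \<or> W = carrier_vec n)"

definition invariant_vectors :: "'g set \<Rightarrow> nat \<Rightarrow> ('g \<Rightarrow> complex mat) \<Rightarrow> complex vec set" where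
  "invariant_vectors H n \<pi> = {v \<in> carrier_vec n. \<forall>h \<in> H. \<pi> h *\<^sub>v v = v}"

text \<open>
  The dimension of the library is the least cardinality of a finite generating set; it is
  meaningful here because \<open>W\<close> will always be a subspace of \<open>\<complex>\<^sup>n\<close>.
\<close>

definition subspace_dim :: "nat \<Rightarrow> complex vec set \<Rightarrow> nat" where
  "subspace_dim n W = vectorspace.dim class_ring (module_vec TYPE(complex) n\<lparr>carrier := W\<rparr>)"

definition gelfand_pair :: "('g, 'b) monoid_scheme \<Rightarrow> 'g set \<Rightarrow> bool" where
  "gelfand_pair G H \<longleftrightarrow>
     (\<forall>n \<pi>. irreducible_representation G n \<pi> \<longrightarrow> subspace_dim n (invariant_vectors H n \<pi>) \<le> 1)"

definition group_involution :: "('g, 'b) monoid_scheme \<Rightarrow> ('g \<Rightarrow> 'g) \<Rightarrow> bool" where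
  "group_involution G \<theta> \<longleftrightarrow> \<theta> \<in> iso G G \<and> (\<forall>x \<in> carrier G. \<theta> (\<theta> x) = x)"

end

theory Submission
  imports Defs "Jordan_Normal_Form.Spectral_Radius"
begin

text \<open>
  Put \<open>\<sigma> x = \<theta> (x\<inverse>)\<close>.  This is an anti-involution of \<open>G\<close> that maps \<open>H\<close> onto itself, and by hypothesis \<open>\<sigma> x\<close>
  is conjugate to \<open>x\<close>.  With \<open>x\<close> replaced by its inverse, the second condition says that \<open>\<sigma>\<close>
  preserves every double coset \<open>H x H\<close>.  Both directions compare the Hecke operators
  \<open>hecke x = E \<pi>(x) E\<close> with \<open>E = \<Sum>h\<in>H. \<pi>(h)\<close> in an irreducible representation \<open>\<pi>\<close>; they depend only on
  the double coset of \<open>x\<close> and act on the space of \<open>H\<close>-fixed vectors.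

  If \<open>\<sigma>\<close> preserves double cosets, then it fixes all Hecke operators while reversing products, so
  they commute (Gelfand's trick, \<open>hecke_commute\<close>).  They also act irreducibly on the fixed vectors
  (\<open>stable_subspace_of_fixed\<close>), and commuting complex operators that act irreducibly live on a space
  of dimension at most one (\<open>fixed_dim_le_1_if_commute\<close>).

  Conversely, suppose that the fixed vectors always have dimension at most one.  Then a Hecke
  operator is a multiple of \<open>E\<close> and is determined by its trace (\<open>hecke_eq_if_trace_eq\<close>).  That trace is
  \<open>card H\<close> times the sum of the character over \<open>x H\<close> (\<open>trace_hecke\<close>).  The character is invariant under
  \<open>\<sigma>\<close> because \<open>\<sigma>\<close> preserves conjugacy classes, and \<open>\<sigma>\<close> carries \<open>x H\<close> to \<open>H \<sigma>(x)\<close>, over which the character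
  has the same sum as over \<open>\<sigma>(x) H\<close>.  So \<open>hecke x = hecke (\<sigma> x)\<close> in every irreducible representation.

  It remains to see that this forces \<open>x\<close> and \<open>\<sigma> x\<close> into the same double coset
  (\<open>same_double_coset_if_hecke_eq\<close>).  A linear relation satisfied by all irreducible
  characters is satisfied by every character, because traces add up along invariant subspaces
  (\<open>trace_sum_zero_if_irreducible\<close>), and the regular character then picks out the coefficient of the
  identity.  Applied to the traces of \<open>hecke x * \<pi> (inv y)\<close> and \<open>hecke y * \<pi> (inv y)\<close>, with \<open>y = \<sigma> x\<close>, this says
  that \<open>y = h x k\<close> has as many solutions in \<open>H\<close> as \<open>y = h y k\<close>, hence at least one.
\<close>

section \<open>Subspaces of complex column vectors\<close>

abbreviation is_subspace :: "nat \<Rightarrow> complex vec set \<Rightarrow> bool" where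
  "is_subspace n W \<equiv> VectorSpace.subspace class_ring W (module_vec TYPE(complex) n)"

lemma is_subspace_iff:
  "is_subspace n W \<longleftrightarrow>
     W \<subseteq> carrier_vec n \<and> 0\<^sub>v n \<in> W \<and> (\<forall>v\<in>W. \<forall>w\<in>W. v + w \<in> W) \<and> (\<forall>c. \<forall>v\<in>W. c \<cdot>\<^sub>v v \<in> W)"
  using vec_vs[where 'a=complex, of n] vec_module[where 'a=complex, of n]
  by (auto simp: VectorSpace.subspace_def LinearCombinations.submodule_def module_vec_simps class_ring_simps)

text \<open>
  A linearly independent set in \<open>W\<close> has at most \<open>n\<close> elements, so there is a maximal one, and
  maximality makes it span \<open>W\<close>.
\<close>
lemma (in vec_space) subspace_has_finite_basis:
  assumes W: "VectorSpace.subspace class_ring W (module_vec TYPE('a) n)"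
  obtains U where "finite U" "U \<subseteq> W" "lin_indpt U" "span U = W"
proof -
  have WC: "W \<subseteq> carrier_vec n" using W by (simp add: VectorSpace.subspace_def LinearCombinations.submodule_def)
  have sub: "submodule class_ring W (module_vec TYPE('a) n)"
    using W by (simp add: VectorSpace.subspace_def)
  have "\<exists>A. finite A \<and> maximal A (\<lambda>S. S \<subseteq> W \<and> lin_indpt S)"
  proof (rule maximal_exists)
    show "finite A \<and> card A \<le> dim" if "A \<subseteq> W \<and> lin_indpt A" for A
    proof -
      have A: "A \<subseteq> carrier_vec n" "lin_indpt A" using that WC by blast+
      show ?thesis using li_le_dim[OF fin_dim A] by (rule conjI)
    qed
    show "{} \<subseteq> W \<and> lin_indpt {}" unfolding lin_dep_def by blast
  qed
  then obtain U where "finite U" and max_U: "maximal U (\<lambda>S. S \<subseteq> W \<and> lin_indpt S)" by blast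
  then have U: "finite U" "U \<subseteq> W" "lin_indpt U" by (simp_all add: maximal_def)
  have UC: "U \<subseteq> carrier_vec n" using U(2) WC by (rule subset_trans)
  have "span U \<subseteq> W" using span_is_subset[OF U(2) sub] .
  moreover have "W \<subseteq> span U"
  proof
    fix w assume w: "w \<in> W"
    show "w \<in> span U"
    proof (cases "w \<in> U")
      case True
      then show ?thesis by (rule subsetD[OF in_own_span[OF UC]])
    next
      case False
      then have "\<not> (U \<union> {w} \<subseteq> W \<and> lin_indpt (U \<union> {w}))"
        using max_U unfolding maximal_def by (metis Un_upper1 UnI2 singletonI)
      then have "lin_dep (U \<union> {w})" using U(2) w by simp
      then show ?thesis using lin_dep_iff_in_span[OF UC U(3) _ False] w WC by (simp add: subset_iff)
    qed
  qed
  ultimately show thesis using that U by blast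
qed

text \<open>
  By the replacement theorem a basis \<open>us\<close> of \<open>W\<close> extends to a basis \<open>us @ cs\<close> of the whole space.
\<close>
lemma subspace_adapted_columns:
  assumes W: "is_subspace n W"
  obtains us cs where
    "set us \<subseteq> carrier_vec n" "set cs \<subseteq> carrier_vec n" "length us + length cs = n"
    "W = {y \<in> carrier_vec n. \<exists>z\<in>carrier_vec (length us). mat_of_cols n us *\<^sub>v z = y}"
    "\<And>v. v \<in> carrier_vec n \<Longrightarrow> \<exists>x\<in>carrier_vec n. mat_of_cols n (us @ cs) *\<^sub>v x = v"
proof -
  interpret vec_space "TYPE(complex)" n .
  obtain U where U: "finite U" "U \<subseteq> W" "lin_indpt U" and WU: "span U = W"
    by (rule subspace_has_finite_basis[OF W])
  have UC: "U \<subseteq> carrier_vec n" using subset_trans[OF U(2)] W by (simp add: is_subspace_iff)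
  have U_span: "U \<subseteq> span (set (unit_vecs n))" using UC by (simp only: span_unit_vecs_is_carrier)
  obtain D where D_all: "finite D \<and> D \<subseteq> carrier_vec n \<and> D \<subseteq> span (set (unit_vecs n)) \<and> D \<inter> U = {} \<and>
      int (card D) \<le> int (card (set (unit_vecs n :: complex vec list))) - int (card U) \<and>
      span (U \<union> D) = span (set (unit_vecs n))"
    using replacement[OF U(1) finite_set unit_vecs_carrier U(3) U_span]
    by (elim exE) (rule that)
  then have D: "finite D" "D \<subseteq> carrier_vec n"
    and cD: "int (card D) \<le> int (card (set (unit_vecs n :: complex vec list))) - int (card U)"
    and span_D: "span (U \<union> D) = span (set (unit_vecs n))"
    by simp_all
  obtain us where us: "set us = U" "distinct us" using finite_distinct_list[OF U(1)] by auto
  obtain cs where cs: "set cs = D" "distinct cs" using finite_distinct_list[OF D(1)] by auto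
  define ws where "ws = us @ cs"
  have ws: "set ws \<subseteq> carrier_vec n" "span (set ws) = carrier_vec n"
    using UC D span_D by (simp_all only: ws_def set_append us cs span_unit_vecs_is_carrier Un_subset_iff simp_thms)
  have "card (set (unit_vecs n :: complex vec list)) = n"
    by (simp only: distinct_card[OF unit_vecs_distinct] unit_vecs_length)
  then have le: "length ws \<le> n"
    using cD distinct_card[OF us(2)] distinct_card[OF cs(2)] us cs by (simp add: ws_def)
  have "n \<le> card (set ws)" using gen_ge_dim[OF finite_set ws] by (simp only: dim_is_n)
  then have len: "length ws = n" using le card_length[of ws] by linarith
  have us_C: "set us \<subseteq> carrier_vec n" and cs_C: "set cs \<subseteq> carrier_vec n"
    using UC D(2) by (simp_all only: us cs)
  have "W = col_space (mat_of_cols n us)"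
    by (simp only: col_space_def cols_mat_of_cols[OF us_C] us WU)
  then have W_col: "W = {y \<in> carrier_vec n. \<exists>z\<in>carrier_vec (length us). mat_of_cols n us *\<^sub>v z = y}"
    by (simp only: col_space_eq[OF mat_of_cols_carrier(1)] mat_of_cols_carrier)
  have P: "mat_of_cols n ws \<in> carrier_mat n n" using mat_of_cols_carrier(1)[of n ws] by (simp only: len)
  have "col_space (mat_of_cols n ws) = carrier_vec n"
    by (simp only: col_space_def cols_mat_of_cols[OF ws(1)] ws(2))
  then have "{y \<in> carrier_vec n. \<exists>x\<in>carrier_vec n. mat_of_cols n ws *\<^sub>v x = y} = carrier_vec n"
    by (simp only: col_space_eq[OF P] carrier_matD[OF P])
  then have onto: "\<exists>x\<in>carrier_vec n. mat_of_cols n (us @ cs) *\<^sub>v x = v" if "v \<in> carrier_vec n" for v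
  proof -
    have "v \<in> {y \<in> carrier_vec n. \<exists>x\<in>carrier_vec n. mat_of_cols n ws *\<^sub>v x = y}"
      using that by (simp only: \<open>{y \<in> carrier_vec n. \<exists>x\<in>carrier_vec n. mat_of_cols n ws *\<^sub>v x = y} = carrier_vec n\<close>)
    then show ?thesis by (simp only: ws_def mem_Collect_eq)
  qed
  show thesis
    by (rule that[OF us_C cs_C _ W_col onto]) (use len in \<open>simp_all only: ws_def length_append\<close>)
qed

lemma mult_mat_zero_vec: "A \<in> carrier_mat m n \<Longrightarrow> A *\<^sub>v 0\<^sub>v n = (0\<^sub>v m :: complex vec)"
  by (intro eq_vecI) auto

lemma zero_mat_mult_vec: "v \<in> carrier_vec n \<Longrightarrow> 0\<^sub>m m n *\<^sub>v v = (0\<^sub>v m :: complex vec)"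
  by (intro eq_vecI) auto

text \<open>
  Coordinates adapted to a subspace, in a form that keeps block matrices out of sight: \<open>B\<close> and \<open>C\<close>
  hold a basis of \<open>W\<close> and of a complement as columns, and \<open>L\<close> and \<open>M\<close> are the two blocks of rows of
  the inverse of \<open>[B | C]\<close>.  Thus \<open>L\<close> reads off coordinates on \<open>W\<close>, and \<open>M\<close> is the quotient map modulo
  \<open>W\<close>.  A matrix \<open>T\<close> that leaves \<open>W\<close> invariant acts on \<open>W\<close> as \<open>L * (T * B)\<close> and on the quotient as
  \<open>M * (T * C)\<close>.
\<close>
lemma subspace_splitting:
  assumes W: "is_subspace n W"
  obtains k B L C M where
    "k \<le> n" "B \<in> carrier_mat n k" "L \<in> carrier_mat k n"
    "C \<in> carrier_mat n (n - k)" "M \<in> carrier_mat (n - k) n"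
    "L * B = 1\<^sub>m k" "M * C = 1\<^sub>m (n - k)" "M * B = 0\<^sub>m (n - k) k" "B * L + C * M = 1\<^sub>m n"
    "W = {w \<in> carrier_vec n. M *\<^sub>v w = 0\<^sub>v (n - k)}"
    "\<And>w. w \<in> W \<Longrightarrow> B *\<^sub>v (L *\<^sub>v w) = w"
proof -
  obtain us cs where us: "set us \<subseteq> carrier_vec n" "set cs \<subseteq> carrier_vec n"
    and len: "length us + length cs = n"
    and W_col: "W = {y \<in> carrier_vec n. \<exists>z\<in>carrier_vec (length us). mat_of_cols n us *\<^sub>v z = y}"
    and onto: "\<And>v. v \<in> carrier_vec n \<Longrightarrow> \<exists>x\<in>carrier_vec n. mat_of_cols n (us @ cs) *\<^sub>v x = v"
    by (rule subspace_adapted_columns[OF W]) blast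
  define k where "k = length us"
  define ws where "ws = us @ cs"
  have k: "k \<le> n" and len_cs: "length cs = n - k" using len by (auto simp: k_def)
  define P where "P = mat_of_cols n ws"
  have P: "P \<in> carrier_mat n n" using mat_of_cols_carrier(1)[of n ws] len by (simp add: P_def ws_def)
  have "\<exists>x\<in>carrier_vec n. P *\<^sub>v x = unit_vec n i" for i
    using onto[of "unit_vec n i"] by (simp add: P_def ws_def)
  then obtain x where x: "\<And>i. x i \<in> carrier_vec n" "\<And>i. P *\<^sub>v x i = unit_vec n i" by metis
  define X where "X = mat_of_cols n (map x [0..<n])"
  have X: "X \<in> carrier_mat n n"
    using mat_of_cols_carrier(1)[of n "map x [0..<n]"] by (simp add: X_def)
  have PX: "P * X = 1\<^sub>m n"
  proof (rule mat_col_eqI)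
    fix j assume "j < dim_col (1\<^sub>m n :: complex mat)"
    then have j: "j < n" by simp
    have "col (P * X) j = P *\<^sub>v col X j" using P X j by (intro col_mult2) auto
    also have "col X j = x j" using j x by (simp add: X_def)
    finally show "col (P * X) j = col (1\<^sub>m n) j" using x j by simp
  qed (use P X in auto)
  have XP: "X * P = 1\<^sub>m n" by (rule mat_mult_left_right_inverse[OF P X PX])
  define B where "B = mat n k (\<lambda>(i,j). P $$ (i,j))"
  define C where "C = mat n (n - k) (\<lambda>(i,j). P $$ (i,k + j))"
  define L where "L = mat k n (\<lambda>(i,j). X $$ (i,j))"
  define M where "M = mat (n - k) n (\<lambda>(i,j). X $$ (k + i,j))"
  have car: "B \<in> carrier_mat n k" "L \<in> carrier_mat k n"
    "C \<in> carrier_mat n (n - k)" "M \<in> carrier_mat (n - k) n"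
    by (auto simp: B_def C_def L_def M_def)
  have XPe: "(\<Sum>l = 0..<n. X $$ (i,l) * P $$ (l,j)) = (if i = j then 1 else 0)"
    if "i < n" "j < n" for i j
    using arg_cong[OF XP, of "\<lambda>A. A $$ (i,j)"] that P X by (auto simp: scalar_prod_def)
  have PXe: "(\<Sum>l = 0..<n. P $$ (i,l) * X $$ (l,j)) = (if i = j then 1 else 0)"
    if "i < n" "j < n" for i j
    using arg_cong[OF PX, of "\<lambda>A. A $$ (i,j)"] that P X by (auto simp: scalar_prod_def)
  have LB: "L * B = 1\<^sub>m k"
    using k by (intro eq_matI) (auto simp: L_def B_def scalar_prod_def XPe)
  have MC: "M * C = 1\<^sub>m (n - k)"
    using k by (intro eq_matI) (auto simp: M_def C_def scalar_prod_def XPe)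
  have MB: "M * B = 0\<^sub>m (n - k) k"
    using k by (intro eq_matI) (auto simp: M_def B_def scalar_prod_def XPe)
  have sum: "B * L + C * M = 1\<^sub>m n"
  proof (rule eq_matI)
    fix i j assume "i < dim_row (1\<^sub>m n :: complex mat)" "j < dim_col (1\<^sub>m n :: complex mat)"
    then have ij: "i < n" "j < n" by auto
    have "(B * L + C * M) $$ (i,j) = (\<Sum>l = 0..<k. P $$ (i,l) * X $$ (l,j))
        + (\<Sum>l = 0..<n - k. P $$ (i,k + l) * X $$ (k + l,j))"
      using ij by (simp add: B_def C_def L_def M_def scalar_prod_def)
    also have "(\<Sum>l = 0..<n - k. P $$ (i,k + l) * X $$ (k + l,j))
        = (\<Sum>l = k..<n. P $$ (i,l) * X $$ (l,j))"
      using sum.shift_bounds_nat_ivl[of "\<lambda>l. P $$ (i,l) * X $$ (l,j)" 0 k "n - k"] k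
      by (simp add: add.commute)
    also have "(\<Sum>l = 0..<k. P $$ (i,l) * X $$ (l,j)) + \<dots> = (\<Sum>l = 0..<n. P $$ (i,l) * X $$ (l,j))"
      using k by (intro sum.atLeastLessThan_concat) auto
    finally show "(B * L + C * M) $$ (i,j) = 1\<^sub>m n $$ (i,j)" using ij PXe by simp
  qed (auto simp: car B_def C_def L_def M_def)
  have B_us: "B = mat_of_cols n us"
    by (rule eq_matI) (auto simp: B_def P_def ws_def k_def mat_of_cols_def nth_append)
  have BL: "B *\<^sub>v (L *\<^sub>v w) = w" if w: "w \<in> carrier_vec n" "M *\<^sub>v w = 0\<^sub>v (n - k)" for w
  proof -
    have "w = (B * L + C * M) *\<^sub>v w" using w by (simp add: sum)
    also have "\<dots> = B *\<^sub>v (L *\<^sub>v w) + C *\<^sub>v (M *\<^sub>v w)"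
      using w(1) car by (subst add_mult_distrib_mat_vec) auto
    also have "\<dots> = B *\<^sub>v (L *\<^sub>v w)" using w car by (simp add: mult_mat_zero_vec[of _ n])
    finally show ?thesis by (rule sym)
  qed
  have W_eq: "W = {w \<in> carrier_vec n. M *\<^sub>v w = 0\<^sub>v (n - k)}"
  proof (intro equalityI subsetI)
    fix w assume "w \<in> W"
    then obtain z where "z \<in> carrier_vec k" "w = B *\<^sub>v z" by (auto simp: W_col k_def B_us)
    then show "w \<in> {w \<in> carrier_vec n. M *\<^sub>v w = 0\<^sub>v (n - k)}"
      using car by (simp flip: assoc_mult_mat_vec add: MB zero_mat_mult_vec)
  next
    fix w assume "w \<in> {w \<in> carrier_vec n. M *\<^sub>v w = 0\<^sub>v (n - k)}"
    then have w: "w \<in> carrier_vec n" "B *\<^sub>v (L *\<^sub>v w) = w" using BL by simp_all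
    moreover have "L *\<^sub>v w \<in> carrier_vec k" using w(1) car by simp
    ultimately show "w \<in> W" by (auto simp: W_col k_def B_us)
  qed
  show thesis by (rule that[OF k car LB MC MB sum W_eq]) (simp add: W_eq BL)
qed

lemma is_subspace_line:
  assumes "v \<in> carrier_vec n"
  shows "is_subspace n (range (\<lambda>c. c \<cdot>\<^sub>v v))"
  unfolding is_subspace_iff
proof (intro conjI ballI allI)
  show "0\<^sub>v n \<in> range (\<lambda>c. c \<cdot>\<^sub>v v)"
    by (rule image_eqI[of _ _ 0]) (use assms in auto)
qed (use assms in \<open>auto simp: smult_smult_assoc simp flip: add_smult_distrib_vec\<close>)

text \<open>
  The dimension is the least size of a generating set, with the span formed inside \<open>W\<close>.  That span
  agrees with the one in the ambient space, where \<open>W\<close> has a finite basis, so the least size is attained.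
\<close>
lemma subspace_dim_le_1_iff:
  assumes W: "is_subspace n W"
  shows "subspace_dim n W \<le> 1 \<longleftrightarrow> (\<exists>v\<in>W. \<forall>w\<in>W. \<exists>c. w = c \<cdot>\<^sub>v v)"
proof -
  interpret vec_space "TYPE(complex)" n .
  have WC: "W \<subseteq> carrier_vec n" using W by (simp add: is_subspace_iff)
  have sub: "LinearCombinations.submodule class_ring W (module_vec TYPE(complex) n)"
    using W by (simp add: VectorSpace.subspace_def)
  interpret w: vectorspace class_ring "module_vec TYPE(complex) n\<lparr>carrier := W\<rparr>"
    by (rule subspace_is_vs[OF W])
  have span: "w.span A = span A" if "A \<subseteq> W" for A
    by (rule span_li_not_depend(1)[OF that sub])
  have span1: "span {v} = range (\<lambda>c. c \<cdot>\<^sub>v v)" if v: "v \<in> carrier_vec n" for v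
  proof
    have vC: "{v} \<subseteq> carrier_vec n" using v by simp
    have "v \<in> range (\<lambda>c. c \<cdot>\<^sub>v v)" by (rule image_eqI[of _ _ 1]) simp_all
    then have vr: "{v} \<subseteq> range (\<lambda>c. c \<cdot>\<^sub>v v)" by simp
    have "LinearCombinations.submodule class_ring (range (\<lambda>c. c \<cdot>\<^sub>v v)) (module_vec TYPE(complex) n)"
      using is_subspace_line[OF v] by (simp add: VectorSpace.subspace_def)
    then show "span {v} \<subseteq> range (\<lambda>c. c \<cdot>\<^sub>v v)" by (rule span_is_subset[OF vr])
    have "is_subspace n (span {v})" using span_is_subspace[OF vC] .
    moreover have "v \<in> span {v}" using in_own_span[OF vC] by simp
    ultimately show "range (\<lambda>c. c \<cdot>\<^sub>v v) \<subseteq> span {v}"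
      by (simp add: is_subspace_iff image_subset_iff)
  qed
  show ?thesis
  proof
    assume "subspace_dim n W \<le> 1"
    then have dim: "w.dim \<le> 1" by (simp add: subspace_dim_def)
    obtain U where U: "finite U" "U \<subseteq> W" "span U = W"
      by (rule subspace_has_finite_basis[OF W])
    then have "w.gen_set U" using span[of U] by simp
    then have "w.fin_dim" unfolding w.fin_dim_def using U by (intro exI[of _ U]) simp
    then obtain A where A: "finite A" "w.basis A" using w.finite_basis_exists by blast
    then have AW: "A \<subseteq> W" "span A = W" "card A \<le> 1"
      using w.dim_basis[of A] span[of A] dim by (simp_all add: w.basis_def)
    consider "A = {}" | v where "A = {v}"
      using AW(3) A(1) by (metis card_0_eq card_1_singletonE le_neq_implies_less less_one)
    then show "\<exists>v\<in>W. \<forall>w\<in>W. \<exists>c. w = c \<cdot>\<^sub>v v"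
    proof cases
      case 1
      then have "W = {0\<^sub>v n}" using AW(2) span_empty by simp
      then show ?thesis by (simp add: exI[of _ 1])
    next
      case 2
      then have "v \<in> W" "W = range (\<lambda>c. c \<cdot>\<^sub>v v)" using AW WC span1[of v] by (simp_all add: subset_iff)
      then show ?thesis by (metis imageE)
    qed
  next
    assume "\<exists>v\<in>W. \<forall>w\<in>W. \<exists>c. w = c \<cdot>\<^sub>v v"
    then obtain v where v: "v \<in> W" "\<forall>w\<in>W. \<exists>c. w = c \<cdot>\<^sub>v v" by blast
    have "range (\<lambda>c. c \<cdot>\<^sub>v v) = W"
    proof
      show "range (\<lambda>c. c \<cdot>\<^sub>v v) \<subseteq> W" using v(1) W by (simp add: is_subspace_iff image_subset_iff)
      show "W \<subseteq> range (\<lambda>c. c \<cdot>\<^sub>v v)" using v(2) by (metis rangeI subsetI)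
    qed
    then have "w.gen_set {v}" using v WC span[of "{v}"] span1[of v] by (simp add: subset_iff)
    then show "subspace_dim n W \<le> 1" using w.dim_le1I[of v] v by (simp add: subspace_dim_def)
  qed
qed

section \<open>Traces, sums of matrices and eigenvectors\<close>

definition mat_trace :: "complex mat \<Rightarrow> complex" where
  "mat_trace A = (\<Sum>i = 0..<dim_row A. A $$ (i,i))"

lemma mat_trace_mult_comm:
  assumes "A \<in> carrier_mat n k" "B \<in> carrier_mat k n"
  shows "mat_trace (A * B) = mat_trace (B * A)"
  using assms sum.swap[of "\<lambda>i j. A $$ (i,j) * B $$ (j,i)" "{0..<k}" "{0..<n}"]
  by (simp add: mat_trace_def scalar_prod_def mult.commute)

lemma mat_trace_add:
  assumes "A \<in> carrier_mat n n" "B \<in> carrier_mat n n"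
  shows "mat_trace (A + B) = mat_trace A + mat_trace B"
  using assms by (simp add: mat_trace_def sum.distrib)

lemma mat_trace_smult: "A \<in> carrier_mat n n \<Longrightarrow> mat_trace (c \<cdot>\<^sub>m A) = c * mat_trace A"
  by (simp add: mat_trace_def sum_distrib_left)

text \<open>
  The dimension is a parameter because an empty sum carries no dimension of its own.
\<close>
definition mat_sum :: "nat \<Rightarrow> 's set \<Rightarrow> ('s \<Rightarrow> complex mat) \<Rightarrow> complex mat" where
  "mat_sum n S F = mat n n (\<lambda>(i,j). \<Sum>s\<in>S. F s $$ (i,j))"

lemma mat_sum_carrier [simp]: "mat_sum n S F \<in> carrier_mat n n"
  by (simp add: mat_sum_def)

lemma mat_sum_cong: "(\<And>s. s \<in> S \<Longrightarrow> F s = F' s) \<Longrightarrow> mat_sum n S F = mat_sum n S F'"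
  by (simp add: mat_sum_def)

lemma mat_sum_reindex:
  "bij_betw f S T \<Longrightarrow> mat_sum n T F = mat_sum n S (\<lambda>s. F (f s))"
  by (intro eq_matI) (auto simp: mat_sum_def intro: sum.reindex_bij_betw[symmetric])

lemma mult_mat_sum:
  assumes "A \<in> carrier_mat n n" "\<And>s. s \<in> S \<Longrightarrow> F s \<in> carrier_mat n n"
  shows "A * mat_sum n S F = mat_sum n S (\<lambda>s. A * F s)"
proof (rule eq_matI)
  fix i j assume "i < dim_row (mat_sum n S (\<lambda>s. A * F s))" "j < dim_col (mat_sum n S (\<lambda>s. A * F s))"
  then have ij: "i < n" "j < n" by (simp_all add: mat_sum_def)
  have "(\<Sum>l = 0..<n. A $$ (i,l) * (\<Sum>s\<in>S. F s $$ (l,j)))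
      = (\<Sum>s\<in>S. \<Sum>l = 0..<n. A $$ (i,l) * F s $$ (l,j))"
    unfolding sum_distrib_left by (rule sum.swap)
  also have "\<dots> = (\<Sum>s\<in>S. (A * F s) $$ (i,j))"
    by (rule sum.cong) (use assms ij in \<open>auto simp: scalar_prod_def dest!: assms(2)\<close>)
  finally show "(A * mat_sum n S F) $$ (i,j) = mat_sum n S (\<lambda>s. A * F s) $$ (i,j)"
    using assms(1) ij by (simp add: mat_sum_def scalar_prod_def)
qed (use assms in \<open>auto simp: mat_sum_def\<close>)

lemma mat_sum_mult:
  assumes "A \<in> carrier_mat n n" "\<And>s. s \<in> S \<Longrightarrow> F s \<in> carrier_mat n n"
  shows "mat_sum n S F * A = mat_sum n S (\<lambda>s. F s * A)"
proof (rule eq_matI)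
  fix i j assume "i < dim_row (mat_sum n S (\<lambda>s. F s * A))" "j < dim_col (mat_sum n S (\<lambda>s. F s * A))"
  then have ij: "i < n" "j < n" by (simp_all add: mat_sum_def)
  have "(\<Sum>l = 0..<n. (\<Sum>s\<in>S. F s $$ (i,l)) * A $$ (l,j))
      = (\<Sum>s\<in>S. \<Sum>l = 0..<n. F s $$ (i,l) * A $$ (l,j))"
    unfolding sum_distrib_right by (rule sum.swap)
  also have "\<dots> = (\<Sum>s\<in>S. (F s * A) $$ (i,j))"
    by (rule sum.cong) (use assms ij in \<open>auto simp: scalar_prod_def dest!: assms(2)\<close>)
  finally show "(mat_sum n S F * A) $$ (i,j) = mat_sum n S (\<lambda>s. F s * A) $$ (i,j)"
    using assms(1) ij by (simp add: mat_sum_def scalar_prod_def)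
qed (use assms in \<open>auto simp: mat_sum_def\<close>)

lemma mat_sum_const:
  "A \<in> carrier_mat n n \<Longrightarrow> mat_sum n S (\<lambda>s. A) = of_nat (card S) \<cdot>\<^sub>m A"
  by (intro eq_matI) (auto simp: mat_sum_def)

lemma mat_trace_mat_sum:
  assumes "\<And>s. s \<in> S \<Longrightarrow> F s \<in> carrier_mat n n"
  shows "mat_trace (mat_sum n S F) = (\<Sum>s\<in>S. mat_trace (F s))"
proof -
  have "mat_trace (mat_sum n S F) = (\<Sum>s\<in>S. \<Sum>i = 0..<n. F s $$ (i,i))"
    unfolding mat_trace_def mat_sum_def by (subst sum.swap) simp
  also have "\<dots> = (\<Sum>s\<in>S. mat_trace (F s))"
    by (rule sum.cong) (auto simp: mat_trace_def dest!: assms)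
  finally show ?thesis .
qed

lemma mat_sum_mult_vec_index:
  assumes "v \<in> carrier_vec n" "i < n" "\<And>s. s \<in> S \<Longrightarrow> F s \<in> carrier_mat n n"
  shows "(mat_sum n S F *\<^sub>v v) $ i = (\<Sum>s\<in>S. (F s *\<^sub>v v) $ i)"
proof -
  have "(\<Sum>l = 0..<n. (\<Sum>s\<in>S. F s $$ (i,l)) * v $ l)
      = (\<Sum>s\<in>S. \<Sum>l = 0..<n. F s $$ (i,l) * v $ l)"
    unfolding sum_distrib_right by (rule sum.swap)
  also have "\<dots> = (\<Sum>s\<in>S. (F s *\<^sub>v v) $ i)"
    by (rule sum.cong) (use assms in \<open>auto simp: scalar_prod_def dest!: assms(3)\<close>)
  finally show ?thesis using assms(1,2) by (simp add: mat_sum_def scalar_prod_def)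
qed

text \<open>
  In coordinates on \<open>W\<close> the restriction of \<open>T\<close> is a square complex matrix of positive size, so it
  has an eigenvalue.
\<close>
lemma invariant_subspace_has_eigenvector:
  assumes T: "T \<in> carrier_mat n n" and W: "is_subspace n W" "W \<noteq> {0\<^sub>v n}"
    and inv: "\<And>w. w \<in> W \<Longrightarrow> T *\<^sub>v w \<in> W"
  obtains c w where "w \<in> W" "w \<noteq> 0\<^sub>v n" "T *\<^sub>v w = c \<cdot>\<^sub>v w"
proof -
  obtain k B L C M where k: "k \<le> n" and car: "B \<in> carrier_mat n k" "L \<in> carrier_mat k n"
    "C \<in> carrier_mat n (n - k)" "M \<in> carrier_mat (n - k) n"
    and eqs: "L * B = 1\<^sub>m k" "M * C = 1\<^sub>m (n - k)" "M * B = 0\<^sub>m (n - k) k" "B * L + C * M = 1\<^sub>m n"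
    and W_eq: "W = {w \<in> carrier_vec n. M *\<^sub>v w = 0\<^sub>v (n - k)}"
    and BL: "\<And>w. w \<in> W \<Longrightarrow> B *\<^sub>v (L *\<^sub>v w) = w"
    by (rule subspace_splitting[OF W(1)]) blast
  have BW: "B *\<^sub>v x \<in> W" if "x \<in> carrier_vec k" for x
    using that car by (simp add: W_eq eqs zero_mat_mult_vec flip: assoc_mult_mat_vec)
  have "k > 0"
  proof (rule ccontr)
    assume "\<not> k > 0"
    have "w = 0\<^sub>v n" if "w \<in> W" for w
    proof -
      have "L *\<^sub>v w = 0\<^sub>v k" using \<open>\<not> k > 0\<close> car by (intro eq_vecI) auto
      then show ?thesis using BL[OF that] car by (simp add: mult_mat_zero_vec[of _ n])
    qed
    then show False using W by (auto simp: is_subspace_iff)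
  qed
  have A: "L * (T * B) \<in> carrier_mat k k" using car T by auto
  obtain c where "eigenvalue (L * (T * B)) c"
    using spectrum_non_empty[OF A \<open>k > 0\<close>] by (auto simp: spectrum_def)
  then obtain x where x: "x \<in> carrier_vec k" "x \<noteq> 0\<^sub>v k" "(L * (T * B)) *\<^sub>v x = c \<cdot>\<^sub>v x"
    using A by (auto simp: eigenvalue_def eigenvector_def)
  have "T *\<^sub>v (B *\<^sub>v x) = B *\<^sub>v (L *\<^sub>v (T *\<^sub>v (B *\<^sub>v x)))"
    using BL[OF inv[OF BW[OF x(1)]]] by simp
  also have "L *\<^sub>v (T *\<^sub>v (B *\<^sub>v x)) = (L * (T * B)) *\<^sub>v x"
    using car T x(1) by (simp add: assoc_mult_mat_vec[of _ k n _ k] assoc_mult_mat_vec[of _ n n _ k]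
      mult_carrier_mat[of _ n n])
  also have "B *\<^sub>v \<dots> = c \<cdot>\<^sub>v (B *\<^sub>v x)" using x car by (simp add: mult_mat_vec)
  finally have eig: "T *\<^sub>v (B *\<^sub>v x) = c \<cdot>\<^sub>v (B *\<^sub>v x)" .
  have "B *\<^sub>v x \<noteq> 0\<^sub>v n"
  proof
    assume "B *\<^sub>v x = 0\<^sub>v n"
    then have "(L * B) *\<^sub>v x = 0\<^sub>v k" using car x(1) by (simp add: mult_mat_zero_vec[of _ k])
    then show False using x eqs by simp
  qed
  then show thesis using that[OF BW[OF x(1)] _ eig] by simp
qed

section \<open>Representations and their Hecke operators\<close>

text \<open>
  A homomorphism into the unit group of the matrix ring is the same as a multiplicative map that
  preserves the identity, since the inverse matrices are supplied by the group.
\<close>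
lemma representation_iff:
  assumes "group G"
  shows "representation G n \<pi> \<longleftrightarrow>
    (\<forall>g\<in>carrier G. \<pi> g \<in> carrier_mat n n) \<and> \<pi> \<one>\<^bsub>G\<^esub> = 1\<^sub>m n \<and>
    (\<forall>g\<in>carrier G. \<forall>h\<in>carrier G. \<pi> (g \<otimes>\<^bsub>G\<^esub> h) = \<pi> g * \<pi> h)"
proof -
  interpret group G by fact
  interpret R: ring "ring_mat TYPE(complex) n ()" by (rule ring_mat)
  have U: "Units (ring_mat TYPE(complex) n ()) = {A \<in> carrier_mat n n. \<exists>B\<in>carrier_mat n n. B * A = 1\<^sub>m n \<and> A * B = 1\<^sub>m n}"
    by (simp add: Units_def ring_mat_simps)
  have gl: "group (GL_complex n)" by (simp add: GL_complex_def R.units_group)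
  show ?thesis
  proof
    assume r: "representation G n \<pi>"
    then have "\<pi> \<one>\<^bsub>G\<^esub> = \<one>\<^bsub>GL_complex n\<^esub>"
      by (intro hom_one[OF _ assms gl]) (simp add: representation_def)
    then show "(\<forall>g\<in>carrier G. \<pi> g \<in> carrier_mat n n) \<and> \<pi> \<one>\<^bsub>G\<^esub> = 1\<^sub>m n \<and>
        (\<forall>g\<in>carrier G. \<forall>h\<in>carrier G. \<pi> (g \<otimes>\<^bsub>G\<^esub> h) = \<pi> g * \<pi> h)"
      using r by (auto simp: representation_def hom_def GL_complex_def units_of_def U ring_mat_simps Pi_def)
  next
    assume r: "(\<forall>g\<in>carrier G. \<pi> g \<in> carrier_mat n n) \<and> \<pi> \<one>\<^bsub>G\<^esub> = 1\<^sub>m n \<and>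
        (\<forall>g\<in>carrier G. \<forall>h\<in>carrier G. \<pi> (g \<otimes>\<^bsub>G\<^esub> h) = \<pi> g * \<pi> h)"
    have "\<pi> g \<in> Units (ring_mat TYPE(complex) n ())" if g: "g \<in> carrier G" for g
    proof -
      have "\<pi> (inv\<^bsub>G\<^esub> g) * \<pi> g = 1\<^sub>m n" "\<pi> g * \<pi> (inv\<^bsub>G\<^esub> g) = 1\<^sub>m n"
        using r g by (metis inv_closed l_inv r_inv)+
      then show ?thesis unfolding U using r g by auto
    qed
    then show "representation G n \<pi>"
      using r by (simp add: representation_def hom_def GL_complex_def units_of_def ring_mat_simps)
  qed
qed

text \<open>
  The Hecke algebra of \<open>(G, H)\<close> acts on the \<open>H\<close>-fixed vectors of a representation.  The matrix \<open>E\<close> below is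
  \<open>card H\<close> times the projection onto the fixed vectors; leaving it unnormalised avoids fractions.  Up to
  scaling, \<open>hecke x\<close> is the operator of the double coset of \<open>x\<close>.
\<close>
locale subgroup_representation = group G for G (structure) +
  fixes H :: "'a set" and n :: nat and \<pi> :: "'a \<Rightarrow> complex mat"
  assumes fin: "finite (carrier G)" and sub: "subgroup H G" and rep: "representation G n \<pi>"
begin

lemma pi_carrier [simp]: "g \<in> carrier G \<Longrightarrow> \<pi> g \<in> carrier_mat n n"
  and pi_one: "\<pi> \<one> = 1\<^sub>m n"
  and pi_mult: "g \<in> carrier G \<Longrightarrow> h \<in> carrier G \<Longrightarrow> \<pi> (g \<otimes> h) = \<pi> g * \<pi> h"
  using rep unfolding representation_iff[OF is_group] by blast+

lemma mult_square [simp]: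
  "A \<in> carrier_mat n n \<Longrightarrow> B \<in> carrier_mat n n \<Longrightarrow> A * B \<in> carrier_mat n n"
  by (rule mult_carrier_mat)

lemma mult_square_vec [simp]:
  "A \<in> carrier_mat n n \<Longrightarrow> v \<in> carrier_vec n \<Longrightarrow> A *\<^sub>v v \<in> carrier_vec n"
  by (rule mult_mat_vec_carrier)

lemmas square_assoc = assoc_mult_mat[of _ n n _ n _ n]
  and square_vec_assoc = assoc_mult_mat_vec[of _ n n _ n]

lemma H_carrier [simp]: "h \<in> H \<Longrightarrow> h \<in> carrier G"
  using subgroup.mem_carrier[OF sub] .

abbreviation N :: complex where "N \<equiv> of_nat (card H)"

lemma card_H_nonzero [simp]: "card H \<noteq> 0"
  using subgroup.finite_imp_card_positive[OF sub fin] by simp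

definition E :: "complex mat" where "E = mat_sum n H \<pi>"

definition hecke :: "'a \<Rightarrow> complex mat" where "hecke x = E * (\<pi> x * E)"

abbreviation fixed :: "complex vec set" where "fixed \<equiv> invariant_vectors H n \<pi>"

lemma E_carrier [simp]: "E \<in> carrier_mat n n" by (simp add: E_def)

lemma hecke_carrier [simp]: "x \<in> carrier G \<Longrightarrow> hecke x \<in> carrier_mat n n"
  unfolding hecke_def by simp

lemma translate_bij:
  assumes "h \<in> H"
  shows "bij_betw (\<lambda>k. h \<otimes> k) H H" "bij_betw (\<lambda>k. k \<otimes> h) H H"
proof -
  interpret H: subgroup H G by (rule sub)
  show "bij_betw (\<lambda>k. h \<otimes> k) H H"
    by (rule bij_betw_byWitness[where f' = "\<lambda>k. inv h \<otimes> k"])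
      (use assms in \<open>auto simp: m_assoc[symmetric]\<close>)
  show "bij_betw (\<lambda>k. k \<otimes> h) H H"
    by (rule bij_betw_byWitness[where f' = "\<lambda>k. k \<otimes> inv h"])
      (use assms in \<open>auto simp: m_assoc\<close>)
qed

lemma pi_E: assumes "h \<in> H" shows "\<pi> h * E = E"
proof -
  have "\<pi> h * E = mat_sum n H (\<lambda>k. \<pi> h * \<pi> k)"
    unfolding E_def by (rule mult_mat_sum) (use assms in auto)
  also have "\<dots> = mat_sum n H (\<lambda>k. \<pi> (h \<otimes> k))"
    by (rule mat_sum_cong) (use assms in \<open>simp add: pi_mult\<close>)
  also have "\<dots> = E" unfolding E_def by (rule mat_sum_reindex[symmetric, OF translate_bij(1)[OF assms]])
  finally show ?thesis .
qed

lemma E_pi: assumes "h \<in> H" shows "E * \<pi> h = E"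
proof -
  have "E * \<pi> h = mat_sum n H (\<lambda>k. \<pi> k * \<pi> h)"
    unfolding E_def by (rule mat_sum_mult) (use assms in auto)
  also have "\<dots> = mat_sum n H (\<lambda>k. \<pi> (k \<otimes> h))"
    by (rule mat_sum_cong) (use assms in \<open>simp add: pi_mult\<close>)
  also have "\<dots> = E" unfolding E_def by (rule mat_sum_reindex[symmetric, OF translate_bij(2)[OF assms]])
  finally show ?thesis .
qed

lemma E_E: "E * E = N \<cdot>\<^sub>m E"
proof -
  have "mat_sum n H \<pi> * E = mat_sum n H (\<lambda>h. \<pi> h * E)"
    by (rule mat_sum_mult) auto
  also have "\<dots> = mat_sum n H (\<lambda>h. E)" by (rule mat_sum_cong) (rule pi_E)
  finally show ?thesis by (simp add: E_def[symmetric] mat_sum_const)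
qed

lemma fixed_carrier: "v \<in> fixed \<Longrightarrow> v \<in> carrier_vec n"
  by (simp add: invariant_vectors_def)

lemma fixed_subspace: "is_subspace n fixed"
  unfolding is_subspace_iff invariant_vectors_def
  by (auto simp: mult_add_distrib_mat_vec[of _ n n] mult_mat_vec[of _ n n] dest!: H_carrier pi_carrier)

lemma E_fixed: "v \<in> fixed \<Longrightarrow> E *\<^sub>v v = N \<cdot>\<^sub>v v"
  unfolding E_def
  by (intro eq_vecI) (auto simp: mat_sum_mult_vec_index invariant_vectors_def carrier_matD[OF mat_sum_carrier] simp del: index_mult_mat_vec)

lemma E_vec_fixed: "u \<in> carrier_vec n \<Longrightarrow> E *\<^sub>v u \<in> fixed"
  unfolding invariant_vectors_def
  by (auto simp: pi_E simp flip: square_vec_assoc)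

lemma hecke_fixed:
  assumes "x \<in> carrier G" "v \<in> fixed"
  shows "hecke x *\<^sub>v v = N \<cdot>\<^sub>v (E *\<^sub>v (\<pi> x *\<^sub>v v))"
proof -
  have v: "v \<in> carrier_vec n" using assms fixed_carrier by simp
  have "hecke x *\<^sub>v v = E *\<^sub>v (\<pi> x *\<^sub>v (E *\<^sub>v v))"
    unfolding hecke_def using assms(1) v
    by (simp add: square_vec_assoc)
  then show ?thesis using assms v by (simp add: E_fixed mult_mat_vec[of _ n n])
qed

lemma hecke_vec_fixed: "x \<in> carrier G \<Longrightarrow> v \<in> fixed \<Longrightarrow> hecke x *\<^sub>v v \<in> fixed"
  using fixed_subspace hecke_fixed[of x v] E_vec_fixed[of "\<pi> x *\<^sub>v v"] fixed_carrier[of v]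
  by (simp add: is_subspace_iff)

text \<open>
  The factors from \<open>H\<close> are absorbed by the copies of \<open>E\<close> on either side.
\<close>
lemma hecke_double_coset:
  assumes "h \<in> H" "k \<in> H" "x \<in> carrier G"
  shows "hecke (h \<otimes> x \<otimes> k) = hecke x"
proof -
  have "hecke (h \<otimes> x \<otimes> k) = (E * \<pi> h) * (\<pi> x * (\<pi> k * E))"
    using assms by (simp add: hecke_def pi_mult square_assoc)
  then show ?thesis using assms by (simp add: pi_E E_pi hecke_def)
qed

text \<open>
  Structure constants of the Hecke algebra: the product contains \<open>E * E\<close>, one factor of which is
  absorbed and the other expanded as a sum over \<open>H\<close>.
\<close>
lemma hecke_mult:
  assumes x: "x \<in> carrier G" and y: "y \<in> carrier G"
  shows "hecke x * hecke y = N \<cdot>\<^sub>m mat_sum n H (\<lambda>h. hecke (x \<otimes> h \<otimes> y))"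
proof -
  have "hecke x * hecke y = E * (\<pi> x * ((E * E) * (\<pi> y * E)))"
    using x y by (simp add: hecke_def square_assoc)
  also have "\<dots> = N \<cdot>\<^sub>m (E * (\<pi> x * (E * (\<pi> y * E))))"
    using x y by (simp add: E_E mult_smult_assoc_mat[of _ n n _ n] mult_smult_distrib[of _ n n _ n])
  also have "E * (\<pi> y * E) = mat_sum n H (\<lambda>h. \<pi> h * (\<pi> y * E))"
    by (subst (1) E_def, rule mat_sum_mult) (use y in auto)
  also have "\<pi> x * \<dots> = mat_sum n H (\<lambda>h. \<pi> x * (\<pi> h * (\<pi> y * E)))"
    by (rule mult_mat_sum) (use x y in auto)
  also have "E * \<dots> = mat_sum n H (\<lambda>h. E * (\<pi> x * (\<pi> h * (\<pi> y * E))))"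
    by (rule mult_mat_sum) (use x y in auto)
  also have "\<dots> = mat_sum n H (\<lambda>h. hecke (x \<otimes> h \<otimes> y))"
    by (rule mat_sum_cong) (use x y in \<open>simp add: hecke_def pi_mult square_assoc\<close>)
  finally show ?thesis .
qed

section \<open>Commuting Hecke operators\<close>

text \<open>
  Gelfand's trick.  An antiautomorphism \<open>\<sigma>\<close> that preserves every double coset fixes every Hecke
  operator, but reverses the order of a product.
\<close>
lemma hecke_commute:
  assumes \<sigma>: "\<And>x. x \<in> carrier G \<Longrightarrow> \<sigma> x \<in> carrier G"
    "\<And>x y. x \<in> carrier G \<Longrightarrow> y \<in> carrier G \<Longrightarrow> \<sigma> (x \<otimes> y) = \<sigma> y \<otimes> \<sigma> x"
    and \<sigma>H: "bij_betw \<sigma> H H"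
    and dc: "\<And>x. x \<in> carrier G \<Longrightarrow> \<exists>h\<in>H. \<exists>k\<in>H. h \<otimes> x \<otimes> k = \<sigma> x"
    and x: "x \<in> carrier G" and y: "y \<in> carrier G"
  shows "hecke x * hecke y = hecke y * hecke x"
proof -
  have inv: "hecke (\<sigma> z) = hecke z" if "z \<in> carrier G" for z
    using dc[OF that] hecke_double_coset that by metis
  have "mat_sum n H (\<lambda>h. hecke (x \<otimes> h \<otimes> y)) = mat_sum n H (\<lambda>h. hecke (\<sigma> y \<otimes> \<sigma> h \<otimes> \<sigma> x))"
  proof (rule mat_sum_cong)
    fix h assume "h \<in> H"
    then show "hecke (x \<otimes> h \<otimes> y) = hecke (\<sigma> y \<otimes> \<sigma> h \<otimes> \<sigma> x)"
      using inv[of "x \<otimes> h \<otimes> y"] x y \<sigma> by (simp add: m_assoc)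
  qed
  also have "\<dots> = mat_sum n H (\<lambda>h. hecke (\<sigma> y \<otimes> h \<otimes> \<sigma> x))"
    by (rule mat_sum_reindex[OF \<sigma>H, symmetric])
  finally have "hecke x * hecke y = hecke (\<sigma> y) * hecke (\<sigma> x)"
    using x y \<sigma>(1) by (simp add: hecke_mult)
  then show ?thesis using x y by (simp add: inv)
qed

text \<open>
  The Hecke algebra acts irreducibly on the fixed vectors of an irreducible representation.  The
  vectors all of whose translates are sent into \<open>K\<close> by \<open>E\<close> form a \<open>G\<close>-invariant subspace containing
  \<open>K\<close>, so they are all vectors; on a fixed vector \<open>E\<close> is a nonzero scalar.
\<close>
lemma stable_subspace_of_fixed:
  assumes irr: "irreducible_representation G n \<pi>"
    and K: "is_subspace n K" "K \<subseteq> fixed" "K \<noteq> {0\<^sub>v n}"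
    and stable: "\<And>x v. x \<in> carrier G \<Longrightarrow> v \<in> K \<Longrightarrow> hecke x *\<^sub>v v \<in> K"
  shows "K = fixed"
proof
  note K_sub = K(1)[unfolded is_subspace_iff]
  \<comment> \<open>The largest \<open>G\<close>-invariant subspace that \<open>E\<close> maps into \<open>K\<close>.\<close>
  define W where "W = {u \<in> carrier_vec n. \<forall>g\<in>carrier G. E *\<^sub>v (\<pi> g *\<^sub>v u) \<in> K}"
  have "is_subspace n W"
    unfolding is_subspace_iff W_def using K_sub
    by (auto simp: mult_add_distrib_mat_vec[of _ n n] mult_mat_vec[of _ n n] mult_mat_zero_vec[of _ n])
  moreover have "\<pi> g *\<^sub>v w \<in> W" if g: "g \<in> carrier G" and w: "w \<in> W" for g w
  proof -
    have wC: "w \<in> carrier_vec n" using w by (simp add: W_def)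
    have "E *\<^sub>v (\<pi> x *\<^sub>v (\<pi> g *\<^sub>v w)) \<in> K" if x: "x \<in> carrier G" for x
    proof -
      have "\<pi> x *\<^sub>v (\<pi> g *\<^sub>v w) = \<pi> (x \<otimes> g) *\<^sub>v w"
        using x g wC by (simp add: pi_mult square_vec_assoc)
      then show ?thesis using w x g by (simp add: W_def)
    qed
    then show ?thesis using g wC by (simp add: W_def)
  qed
  ultimately have "W = {0\<^sub>v n} \<or> W = carrier_vec n"
    using irr by (simp add: irreducible_representation_def invariant_subspace_def)
  moreover have scale: "v \<in> K" if "N \<cdot>\<^sub>v v \<in> K" for v
  proof -
    have "(1 / N) \<cdot>\<^sub>v (N \<cdot>\<^sub>v v) \<in> K" using K_sub that by blast
    then show ?thesis by (simp add: smult_smult_assoc)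
  qed
  have "K \<subseteq> W"
  proof
    fix v assume v: "v \<in> K"
    have "E *\<^sub>v (\<pi> g *\<^sub>v v) \<in> K" if g: "g \<in> carrier G" for g
    proof (rule scale)
      have "v \<in> fixed" using v K(2) by blast
      then show "N \<cdot>\<^sub>v (E *\<^sub>v (\<pi> g *\<^sub>v v)) \<in> K" using stable[OF g v] g by (simp add: hecke_fixed)
    qed
    then show "v \<in> W" using v K_sub by (auto simp: W_def)
  qed
  then have "W \<noteq> {0\<^sub>v n}" using K(3) K_sub by auto
  ultimately have W: "W = carrier_vec n" by simp
  show "fixed \<subseteq> K"
  proof
    fix v assume v: "v \<in> fixed"
    then have "E *\<^sub>v (\<pi> \<one> *\<^sub>v v) \<in> K" using W fixed_carrier[OF v] by (auto simp: W_def)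
    then have "N \<cdot>\<^sub>v v \<in> K" using v fixed_carrier[OF v] by (simp add: pi_one E_fixed)
    then show "v \<in> K" by (rule scale)
  qed
qed (rule K(2))

text \<open>
  Schur's argument: an eigenspace of one Hecke operator is stable under all others once they
  commute, so by irreducibility it contains every fixed vector.
\<close>
lemma hecke_scalar_on_fixed:
  assumes irr: "irreducible_representation G n \<pi>"
    and comm: "\<And>x y. x \<in> carrier G \<Longrightarrow> y \<in> carrier G \<Longrightarrow> hecke x * hecke y = hecke y * hecke x"
    and x: "x \<in> carrier G"
  obtains c where "\<And>v. v \<in> fixed \<Longrightarrow> hecke x *\<^sub>v v = c \<cdot>\<^sub>v v"
proof (cases "fixed = {0\<^sub>v n}")
  case True
  have "hecke x *\<^sub>v v = 0 \<cdot>\<^sub>v v" if "v \<in> fixed" for v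
    using that x True hecke_vec_fixed[OF x that] by auto
  then show thesis by (rule that)
next
  case False
  obtain c w where w: "w \<in> fixed" "w \<noteq> 0\<^sub>v n" "hecke x *\<^sub>v w = c \<cdot>\<^sub>v w"
    by (rule invariant_subspace_has_eigenvector[OF hecke_carrier[OF x] fixed_subspace False])
      (use hecke_vec_fixed[OF x] in auto)
  define K where "K = {v \<in> fixed. hecke x *\<^sub>v v = c \<cdot>\<^sub>v v}"
  have "is_subspace n K"
    using fixed_subspace hecke_carrier[OF x] fixed_carrier unfolding is_subspace_iff K_def
    by (auto simp: mult_add_distrib_mat_vec[of _ n n] mult_mat_vec[of _ n n] smult_add_distrib_vec[of _ n]
        smult_smult_assoc mult.commute)
  moreover have "hecke y *\<^sub>v v \<in> K" if y: "y \<in> carrier G" and v: "v \<in> K" for y v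
  proof -
    have vf: "v \<in> fixed" and vC: "v \<in> carrier_vec n" and eig: "hecke x *\<^sub>v v = c \<cdot>\<^sub>v v"
      using v fixed_carrier by (auto simp: K_def)
    have "hecke x *\<^sub>v (hecke y *\<^sub>v v) = (hecke x * hecke y) *\<^sub>v v"
      using x y vC by (simp add: square_vec_assoc)
    also have "\<dots> = hecke y *\<^sub>v (hecke x *\<^sub>v v)"
      using x y vC by (simp add: comm[OF x y] square_vec_assoc)
    also have "\<dots> = c \<cdot>\<^sub>v (hecke y *\<^sub>v v)"
      using y vC by (simp add: eig mult_mat_vec[of _ n n])
    finally show ?thesis using hecke_vec_fixed[OF y vf] by (simp add: K_def)
  qed
  moreover have "K \<subseteq> fixed" "K \<noteq> {0\<^sub>v n}" using w by (auto simp: K_def)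
  ultimately have K: "K = fixed" by (intro stable_subspace_of_fixed[OF irr])
  show thesis
  proof (rule that)
    fix v assume "v \<in> fixed"
    then have "v \<in> K" by (simp only: K)
    then show "hecke x *\<^sub>v v = c \<cdot>\<^sub>v v" by (simp add: K_def)
  qed
qed

text \<open>
  When all Hecke operators are scalars, every line of fixed vectors is stable, hence is the whole
  space of fixed vectors.
\<close>
lemma fixed_dim_le_1_if_commute:
  assumes irr: "irreducible_representation G n \<pi>"
    and comm: "\<And>x y. x \<in> carrier G \<Longrightarrow> y \<in> carrier G \<Longrightarrow> hecke x * hecke y = hecke y * hecke x"
  shows "subspace_dim n fixed \<le> 1"
proof (cases "fixed = {0\<^sub>v n}")
  case True
  then show ?thesis unfolding subspace_dim_le_1_iff[OF fixed_subspace] by (auto intro: exI[of _ 1])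
next
  case False
  then obtain v where v: "v \<in> fixed" "v \<noteq> 0\<^sub>v n"
    using fixed_subspace by (auto simp: is_subspace_iff)
  note vC = fixed_carrier[OF v(1)]
  have "range (\<lambda>c. c \<cdot>\<^sub>v v) = fixed"
  proof (rule stable_subspace_of_fixed[OF irr is_subspace_line[OF vC]])
    show "range (\<lambda>c. c \<cdot>\<^sub>v v) \<subseteq> fixed" using v fixed_subspace by (auto simp: is_subspace_iff)
    have "1 \<cdot>\<^sub>v v \<in> range (\<lambda>c. c \<cdot>\<^sub>v v)" by (rule rangeI)
    then show "range (\<lambda>c. c \<cdot>\<^sub>v v) \<noteq> {0\<^sub>v n}" using v(2) by auto
    fix x w assume x: "x \<in> carrier G" and "w \<in> range (\<lambda>c. c \<cdot>\<^sub>v v)"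
    then obtain a where w: "w = a \<cdot>\<^sub>v v" by auto
    obtain c where c: "\<And>v. v \<in> fixed \<Longrightarrow> hecke x *\<^sub>v v = c \<cdot>\<^sub>v v"
      by (rule hecke_scalar_on_fixed[OF irr comm x]) auto
    have "hecke x *\<^sub>v w = (a * c) \<cdot>\<^sub>v v"
      using x vC v(1) by (simp add: w c mult_mat_vec[of _ n n] smult_smult_assoc)
    then show "hecke x *\<^sub>v w \<in> range (\<lambda>c. c \<cdot>\<^sub>v v)" by simp
  qed
  then show ?thesis unfolding subspace_dim_le_1_iff[OF fixed_subspace] using v by blast
qed

section \<open>One-dimensional spaces of fixed vectors\<close>

text \<open>
  If the fixed vectors lie on a line spanned by \<open>v\<close>, then \<open>E\<close> is a rank-one matrix with column
  space in that line, so \<open>E * A * E\<close> is a multiple of \<open>E\<close> for every \<open>A\<close>.  The multiple is determined by the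
  trace, because \<open>E\<close> has trace \<open>card H\<close> unless it vanishes.
\<close>
lemma hecke_eq_if_trace_eq:
  assumes dim: "subspace_dim n fixed \<le> 1"
    and x: "x \<in> carrier G" and y: "y \<in> carrier G"
    and tr: "mat_trace (hecke x) = mat_trace (hecke y)"
  shows "hecke x = hecke y"
proof -
  obtain v where v: "v \<in> fixed" "\<And>w. w \<in> fixed \<Longrightarrow> \<exists>c. w = c \<cdot>\<^sub>v v"
    using dim unfolding subspace_dim_le_1_iff[OF fixed_subspace] by blast
  note vC = fixed_carrier[OF v(1)]
  have "\<exists>c. col E j = c \<cdot>\<^sub>v v" if "j < n" for j
  proof -
    have "col E j = E *\<^sub>v unit_vec n j" using that carrier_matD[OF E_carrier] by (intro eq_vecI) auto
    then show ?thesis using v(2)[OF E_vec_fixed, of "unit_vec n j"] by simp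
  qed
  \<comment> \<open>So \<open>E\<close> is the outer product of \<open>v\<close> and \<open>w\<close>; its trace is read off from \<open>E *\<^sub>v v = N \<cdot>\<^sub>v v\<close> below.\<close>
  then obtain w where w: "\<And>j. j < n \<Longrightarrow> col E j = w j \<cdot>\<^sub>v v" by metis
  have scalar: "\<exists>c. hecke z = c \<cdot>\<^sub>m E" if z: "z \<in> carrier G" for z
  proof -
    obtain c where c: "E *\<^sub>v (\<pi> z *\<^sub>v v) = c \<cdot>\<^sub>v v"
      using v(2)[OF E_vec_fixed, of "\<pi> z *\<^sub>v v"] z vC by auto
    have "hecke z = c \<cdot>\<^sub>m E"
    proof (rule mat_col_eqI)
      fix j assume "j < dim_col (c \<cdot>\<^sub>m E)"
      then have j: "j < n" using carrier_matD(2)[OF E_carrier] by simp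
      have "col (hecke z) j = E *\<^sub>v (\<pi> z *\<^sub>v col E j)"
        using z j unfolding hecke_def
        by (simp add: col_mult2[of E n n "\<pi> z * E" n] col_mult2[of "\<pi> z" n n E n])
      also have "\<dots> = w j \<cdot>\<^sub>v (E *\<^sub>v (\<pi> z *\<^sub>v v))"
        using z vC by (simp add: w[OF j] mult_mat_vec[of _ n n])
      also have "\<dots> = c \<cdot>\<^sub>v col E j"
        by (simp add: c w[OF j] smult_smult_assoc mult.commute)
      also have "\<dots> = col (c \<cdot>\<^sub>m E) j"
        using j carrier_matD[OF E_carrier] by (intro eq_vecI) auto
      finally show "col (hecke z) j = col (c \<cdot>\<^sub>m E) j" .
    qed (use carrier_matD[OF hecke_carrier[OF z]] carrier_matD[OF E_carrier] in auto)
    then show ?thesis by blast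
  qed
  obtain c d where cd: "hecke x = c \<cdot>\<^sub>m E" "hecke y = d \<cdot>\<^sub>m E"
    using scalar[OF x] scalar[OF y] by blast
  have E_entry: "E $$ (i,j) = w j * v $ i" if "i < n" "j < n" for i j
    using arg_cong[OF w[OF that(2)], of "\<lambda>u. u $ i"] that vC carrier_matD[OF E_carrier] by simp
  show ?thesis
  proof (cases "v = 0\<^sub>v n")
    case True
    have "E = 0\<^sub>m n n" using carrier_matD[OF E_carrier] by (intro eq_matI) (auto simp: E_entry True)
    then show ?thesis by (simp add: cd)
  next
    case False
    then obtain i where i: "i < n" "v $ i \<noteq> 0" using vC by (auto simp: vec_eq_iff)
    have "(E *\<^sub>v v) $ i = (\<Sum>j = 0..<n. w j * v $ i * v $ j)"
      using i(1) vC carrier_matD[OF E_carrier] by (simp add: scalar_prod_def E_entry)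
    also have "\<dots> = v $ i * mat_trace E"
      using carrier_matD[OF E_carrier] by (simp add: mat_trace_def E_entry sum_distrib_left algebra_simps)
    finally have "N = mat_trace E"
      using E_fixed[OF v(1)] i vC by simp
    then have "mat_trace E \<noteq> 0" by (simp flip: \<open>N = mat_trace E\<close>)
    then show ?thesis using tr by (simp add: cd mat_trace_smult[OF E_carrier])
  qed
qed

text \<open>
  The trace of a Hecke operator depends on the character alone.  This is what turns a conjugacy
  hypothesis in the group into an equation between Hecke operators.
\<close>
lemma trace_hecke:
  assumes x: "x \<in> carrier G"
  shows "mat_trace (hecke x) = N * (\<Sum>h\<in>H. mat_trace (\<pi> (x \<otimes> h)))"
proof -
  have "mat_trace (hecke x) = mat_trace ((\<pi> x * E) * E)"
    unfolding hecke_def by (rule mat_trace_mult_comm[of _ n n]) (use x in auto)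
  also have "(\<pi> x * E) * E = N \<cdot>\<^sub>m (\<pi> x * E)"
    using x by (simp add: square_assoc E_E mult_smult_distrib[of _ n n _ n])
  also have "\<pi> x * E = mat_sum n H (\<lambda>h. \<pi> x * \<pi> h)"
    unfolding E_def by (rule mult_mat_sum) (use x in auto)
  also have "\<dots> = mat_sum n H (\<lambda>h. \<pi> (x \<otimes> h))"
    by (rule mat_sum_cong) (use x in \<open>simp add: pi_mult\<close>)
  finally show ?thesis using x by (simp add: mat_trace_smult[of _ n] mat_trace_mat_sum[of H _ n])
qed

lemma trace_hecke_mult:
  assumes x: "x \<in> carrier G" and y: "y \<in> carrier G"
  shows "mat_trace (hecke x * \<pi> y) = (\<Sum>(h, k)\<in>H \<times> H. mat_trace (\<pi> (h \<otimes> x \<otimes> k \<otimes> y)))"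
proof -
  have "hecke x * \<pi> y = E * (\<pi> x * (E * \<pi> y))" using x y by (simp add: hecke_def square_assoc)
  also have "\<dots> = mat_sum n H (\<lambda>h. \<pi> h * (\<pi> x * (E * \<pi> y)))"
    by (subst (1) E_def, rule mat_sum_mult) (use x y in auto)
  finally have "mat_trace (hecke x * \<pi> y) = (\<Sum>h\<in>H. mat_trace (\<pi> h * (\<pi> x * (E * \<pi> y))))"
    using x y by (simp add: mat_trace_mat_sum[of H _ n])
  also have "\<dots> = (\<Sum>h\<in>H. \<Sum>k\<in>H. mat_trace (\<pi> (h \<otimes> x \<otimes> k \<otimes> y)))"
  proof (rule sum.cong[OF refl])
    fix h assume h: "h \<in> H"
    have "E * \<pi> y = mat_sum n H (\<lambda>k. \<pi> k * \<pi> y)"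
      unfolding E_def by (rule mat_sum_mult) (use y in auto)
    then have "\<pi> h * (\<pi> x * (E * \<pi> y)) = (\<pi> h * \<pi> x) * mat_sum n H (\<lambda>k. \<pi> k * \<pi> y)"
      using h x y by (simp add: square_assoc)
    also have "\<dots> = mat_sum n H (\<lambda>k. (\<pi> h * \<pi> x) * (\<pi> k * \<pi> y))"
      by (rule mult_mat_sum) (use h x y in auto)
    also have "\<dots> = mat_sum n H (\<lambda>k. \<pi> (h \<otimes> x \<otimes> k \<otimes> y))"
      by (rule mat_sum_cong) (use h x y in \<open>simp add: pi_mult square_assoc\<close>)
    finally show "mat_trace (\<pi> h * (\<pi> x * (E * \<pi> y))) = (\<Sum>k\<in>H. mat_trace (\<pi> (h \<otimes> x \<otimes> k \<otimes> y)))"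
      using h x y by (simp add: mat_trace_mat_sum[of H _ n])
  qed
  finally show ?thesis by (simp add: sum.cartesian_product)
qed

end

section \<open>Irreducible characters detect the identity\<close>

text \<open>
  The trace of a representation is the sum of its traces on an invariant subspace and on the
  quotient, so a linear relation between the values of all irreducible characters passes to all
  representations by induction on the dimension.
\<close>
lemma trace_sum_zero_if_irreducible:
  fixes G (structure) and c :: "'a \<Rightarrow> complex"
  assumes G: "group G"
    and irr: "\<And>m \<pi>. irreducible_representation G m \<pi> \<Longrightarrow> (\<Sum>g\<in>carrier G. c g * mat_trace (\<pi> g)) = 0"
    and rep: "representation G n \<rho>"
  shows "(\<Sum>g\<in>carrier G. c g * mat_trace (\<rho> g)) = 0"
  using rep
proof (induction n arbitrary: \<rho> rule: less_induct)
  case (less n)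
  have \<rho>: "\<And>g. g \<in> carrier G \<Longrightarrow> \<rho> g \<in> carrier_mat n n" "\<rho> \<one> = 1\<^sub>m n"
    "\<And>g h. g \<in> carrier G \<Longrightarrow> h \<in> carrier G \<Longrightarrow> \<rho> (g \<otimes> h) = \<rho> g * \<rho> h"
    using less.prems unfolding representation_iff[OF G] by blast+
  interpret group G by (rule G)
  show ?case
  proof (cases "n = 0 \<or> irreducible_representation G n \<rho>")
    case True
    then show ?thesis
    proof
      assume "n = 0"
      then have "mat_trace (\<rho> g) = 0" if "g \<in> carrier G" for g
        using \<rho>(1)[OF that] by (simp add: mat_trace_def)
      then show ?thesis by simp
    qed (rule irr)
  next
    case False
    then obtain W where W: "invariant_subspace G n \<rho> W" "W \<noteq> {0\<^sub>v n}" "W \<noteq> carrier_vec n"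
      using less.prems by (auto simp: irreducible_representation_def)
    then have Ws: "is_subspace n W"
      and W_inv: "\<And>g w. g \<in> carrier G \<Longrightarrow> w \<in> W \<Longrightarrow> \<rho> g *\<^sub>v w \<in> W"
      by (auto simp: invariant_subspace_def)
    obtain k B L C M where k: "k \<le> n" and car: "B \<in> carrier_mat n k" "L \<in> carrier_mat k n"
      "C \<in> carrier_mat n (n - k)" "M \<in> carrier_mat (n - k) n"
      and eqs: "L * B = 1\<^sub>m k" "M * C = 1\<^sub>m (n - k)" "M * B = 0\<^sub>m (n - k) k" "B * L + C * M = 1\<^sub>m n"
      and W_eq: "W = {w \<in> carrier_vec n. M *\<^sub>v w = 0\<^sub>v (n - k)}"
      and BL: "\<And>w. w \<in> W \<Longrightarrow> B *\<^sub>v (L *\<^sub>v w) = w"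
      by (rule subspace_splitting[OF Ws]) blast
    have "k \<noteq> n"
    proof
      assume "k = n"
      then have "M *\<^sub>v w = 0\<^sub>v (n - k)" for w using car by (intro eq_vecI) auto
      then show False using W(3) W_eq by simp
    qed
    moreover have "k \<noteq> 0"
    proof
      assume "k = 0"
      have "w = 0\<^sub>v n" if w: "w \<in> W" for w
      proof -
        have "L *\<^sub>v w = 0\<^sub>v k" using car \<open>k = 0\<close> by (intro eq_vecI) auto
        then show ?thesis using BL[OF w] car by (simp add: mult_mat_zero_vec[of _ n])
      qed
      then show False using W(2) Ws by (auto simp: is_subspace_iff)
    qed
    ultimately have smaller: "k < n" "n - k < n" using k by auto
    \<comment> \<open>The block below the diagonal vanishes because \<open>W\<close> is invariant.\<close>
    have block: "M * (\<rho> g * B) = 0\<^sub>m (n - k) k" if g: "g \<in> carrier G" for g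
    proof (rule mat_col_eqI)
      fix j assume "j < dim_col (0\<^sub>m (n - k) k :: complex mat)"
      then have j: "j < k" by simp
      have "M *\<^sub>v col B j = col (M * B) j" using col_mult2[OF car(4,1) j] by (rule sym)
      then have "col B j \<in> W" using car j by (auto simp: W_eq eqs)
      then have "M *\<^sub>v (\<rho> g *\<^sub>v col B j) = 0\<^sub>v (n - k)" using W_inv[OF g] by (simp add: W_eq)
      moreover have "col (M * (\<rho> g * B)) j = M *\<^sub>v (\<rho> g *\<^sub>v col B j)"
        using col_mult2[OF car(4) mult_carrier_mat[OF \<rho>(1)[OF g] car(1)] j]
          col_mult2[OF \<rho>(1)[OF g] car(1) j] by (simp only:)
      ultimately show "col (M * (\<rho> g * B)) j = col (0\<^sub>m (n - k) k) j" using j by simp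
    qed (use car \<rho>(1)[OF g] in auto)
    define \<rho>W where "\<rho>W g = L * (\<rho> g * B)" for g
    define \<rho>Q where "\<rho>Q g = M * (\<rho> g * C)" for g
    have carW: "\<rho>W g \<in> carrier_mat k k" and carQ: "\<rho>Q g \<in> carrier_mat (n - k) (n - k)"
      if "g \<in> carrier G" for g
      using \<rho>(1)[OF that] car by (auto simp: \<rho>W_def \<rho>Q_def)
    have mult: "\<rho>W (g \<otimes> h) = \<rho>W g * \<rho>W h \<and> \<rho>Q (g \<otimes> h) = \<rho>Q g * \<rho>Q h"
      if g: "g \<in> carrier G" and h: "h \<in> carrier G" for g h
    proof -
      note c = car \<rho>(1)[OF g] \<rho>(1)[OF h]
      note [simp] = mult_carrier_mat[of _ n n] mult_carrier_mat[of _ k n] mult_carrier_mat[of _ n k]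
        mult_carrier_mat[of _ "n - k" n] mult_carrier_mat[of _ n "n - k"]
      \<comment> \<open>Inserting \<open>B * L + C * M\<close>, which is the identity, between the two factors.\<close>
      have split_one: "X * (\<rho> g * (\<rho> h * Y)) = X * (\<rho> g * (B * (L * (\<rho> h * Y)))) + X * (\<rho> g * (C * (M * (\<rho> h * Y))))"
        if "X \<in> carrier_mat r n" "Y \<in> carrier_mat n r" for X Y r
      proof -
        have "\<rho> h * Y = (B * L + C * M) * (\<rho> h * Y)" using that c by (simp add: eqs)
        also have "\<dots> = B * (L * (\<rho> h * Y)) + C * (M * (\<rho> h * Y))"
          using that c by (simp add: add_mult_distrib_mat[of _ n n _ _ r] assoc_mult_mat[of _ n k _ n _ r]
            assoc_mult_mat[of _ n "n - k" _ n _ r])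
        finally have "X * (\<rho> g * (\<rho> h * Y)) = X * (\<rho> g * (B * (L * (\<rho> h * Y)) + C * (M * (\<rho> h * Y))))"
          by (rule arg_cong[where f = "\<lambda>Z. X * (\<rho> g * Z)"])
        then show ?thesis
          using that c by (simp add: mult_add_distrib_mat[of _ n n _ r] mult_add_distrib_mat[of _ r n _ r])
      qed
      have "\<rho>W (g \<otimes> h) = L * (\<rho> g * (\<rho> h * B))"
        unfolding \<rho>W_def using c by (simp add: \<rho>(3)[OF g h] assoc_mult_mat[of _ n n _ n _ k])
      also have "\<dots> = L * (\<rho> g * (B * (L * (\<rho> h * B))))"
        using split_one[OF car(2,1)] block[OF h] c
        by (simp add: right_mult_zero_mat[of _ n] right_mult_zero_mat[of _ k])
      also have "\<dots> = \<rho>W g * \<rho>W h"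
        unfolding \<rho>W_def using c by (simp add: assoc_mult_mat[of _ k n _ k _ k] assoc_mult_mat[of _ n n _ k _ k])
      finally have 1: "\<rho>W (g \<otimes> h) = \<rho>W g * \<rho>W h" .
      have "\<rho>Q (g \<otimes> h) = M * (\<rho> g * (\<rho> h * C))"
        unfolding \<rho>Q_def using c by (simp add: \<rho>(3)[OF g h] assoc_mult_mat[of _ n n _ n _ "n - k"])
      also have "\<dots> = M * (\<rho> g * B) * (L * (\<rho> h * C)) + M * (\<rho> g * C) * (M * (\<rho> h * C))"
        using split_one[OF car(4,3)] c
        by (simp add: assoc_mult_mat[of _ "n - k" n _ k _ "n - k"] assoc_mult_mat[of _ n n _ k _ "n - k"]
          assoc_mult_mat[of _ "n - k" n _ "n - k" _ "n - k"] assoc_mult_mat[of _ n n _ "n - k" _ "n - k"])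
      also have "\<dots> = \<rho>Q g * \<rho>Q h"
        using c block[OF g] carQ[OF g] carQ[OF h] unfolding \<rho>Q_def
        by (simp add: left_mult_zero_mat[of _ k "n - k"] left_add_zero_mat[of _ "n - k" "n - k"]
            mult_carrier_mat[of _ "n - k" "n - k"])
      finally show ?thesis using 1 by simp
    qed
    have repW: "representation G k \<rho>W" and repQ: "representation G (n - k) \<rho>Q"
      unfolding representation_iff[OF G] using carW carQ mult \<rho>(2) car eqs
      by (simp_all add: \<rho>W_def \<rho>Q_def)
    have trace: "mat_trace (\<rho> g) = mat_trace (\<rho>W g) + mat_trace (\<rho>Q g)" if g: "g \<in> carrier G" for g
    proof -
      note c = car \<rho>(1)[OF g]
      note [simp] = mult_carrier_mat[of _ n n] mult_carrier_mat[of _ k n] mult_carrier_mat[of _ n k]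
        mult_carrier_mat[of _ "n - k" n] mult_carrier_mat[of _ n "n - k"]
      have "\<rho> g = \<rho> g * (B * L + C * M)" using c by (simp add: eqs)
      also have "\<dots> = (\<rho> g * B) * L + (\<rho> g * C) * M"
        using c by (simp add: mult_add_distrib_mat[of _ n n _ n] assoc_mult_mat[of _ n n _ k _ n]
          assoc_mult_mat[of _ n n _ "n - k" _ n])
      finally have "mat_trace (\<rho> g) = mat_trace ((\<rho> g * B) * L + (\<rho> g * C) * M)"
        by (rule arg_cong)
      also have "\<dots> = mat_trace ((\<rho> g * B) * L) + mat_trace ((\<rho> g * C) * M)"
        by (rule mat_trace_add[of _ n]) (use c in simp_all)
      also have "mat_trace ((\<rho> g * B) * L) = mat_trace (\<rho>W g)"
        unfolding \<rho>W_def by (rule mat_trace_mult_comm[of _ n k]) (use c in simp_all)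
      also have "mat_trace ((\<rho> g * C) * M) = mat_trace (\<rho>Q g)"
        unfolding \<rho>Q_def by (rule mat_trace_mult_comm[of _ n "n - k"]) (use c in simp_all)
      finally show ?thesis .
    qed
    have "(\<Sum>g\<in>carrier G. c g * mat_trace (\<rho> g))
        = (\<Sum>g\<in>carrier G. c g * mat_trace (\<rho>W g)) + (\<Sum>g\<in>carrier G. c g * mat_trace (\<rho>Q g))"
      by (simp add: trace distrib_left sum.distrib)
    then show ?thesis using less.IH[OF smaller(1) repW] less.IH[OF smaller(2) repQ] by simp
  qed
qed

text \<open>
  Left translation is a permutation of the group; a nontrivial element has no fixed point, so the
  trace of its permutation matrix is zero.
\<close>
lemma regular_representation:
  fixes G (structure)
  assumes G: "group G" and fin: "finite (carrier G)"
  obtains n \<rho> where "representation G n \<rho>"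
    "\<And>g. g \<in> carrier G \<Longrightarrow> mat_trace (\<rho> g) = (if g = \<one> then of_nat (card (carrier G)) else 0)"
proof -
  interpret group G by (rule G)
  define n where "n = card (carrier G)"
  obtain b where b: "bij_betw b {0..<n} (carrier G)"
    using ex_bij_betw_nat_finite[OF fin] unfolding n_def by blast
  have bC [simp]: "b i \<in> carrier G" if "i < n" for i
    using bij_betwE[OF b] that by auto
  have b_inj: "b i = b j \<longleftrightarrow> i = j" if "i < n" "j < n" for i j
    using bij_betw_imp_inj_on[OF b] that by (auto dest: inj_onD)
  define \<rho> :: "'a \<Rightarrow> complex mat"
    where "\<rho> g = mat n n (\<lambda>(i,j). of_bool (b i = g \<otimes> b j))" for g
  have \<rho>_carrier: "\<rho> g \<in> carrier_mat n n" for g by (simp add: \<rho>_def)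
  have "\<rho> (g \<otimes> h) = \<rho> g * \<rho> h" if g: "g \<in> carrier G" and h: "h \<in> carrier G" for g h
  proof (rule eq_matI)
    fix i j assume "i < dim_row (\<rho> g * \<rho> h)" "j < dim_col (\<rho> g * \<rho> h)"
    then have ij: "i < n" "j < n" by (simp_all add: \<rho>_def)
    obtain l where l: "l < n" "b l = h \<otimes> b j"
      using bij_betw_imp_surj_on[OF b] h ij by (metis atLeastLessThan_iff bC imageE m_closed)
    have "(\<rho> g * \<rho> h) $$ (i,j) = (\<Sum>k = 0..<n. of_bool (b i = g \<otimes> b k) * of_bool (b k = h \<otimes> b j))"
      using ij by (simp add: \<rho>_def scalar_prod_def)
    also have "\<dots> = (\<Sum>k = 0..<n. if k = l then of_bool (b i = g \<otimes> b l) else 0)"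
      by (rule sum.cong[OF refl]) (use l b_inj in \<open>auto simp flip: l(2)\<close>)
    also have "\<dots> = of_bool (b i = g \<otimes> (h \<otimes> b j))" using l by simp
    finally show "\<rho> (g \<otimes> h) $$ (i,j) = (\<rho> g * \<rho> h) $$ (i,j)"
      using ij g h by (simp add: \<rho>_def m_assoc)
  qed (simp_all add: \<rho>_def)
  moreover have "\<rho> \<one> = 1\<^sub>m n" by (rule eq_matI) (simp_all add: \<rho>_def b_inj)
  ultimately have rep: "representation G n \<rho>"
    unfolding representation_iff[OF G] using \<rho>_carrier by blast
  have tr: "mat_trace (\<rho> g) = (if g = \<one> then of_nat (card (carrier G)) else 0)"
    if g: "g \<in> carrier G" for g
  proof -
    have "b i = g \<otimes> b i \<longleftrightarrow> g = \<one>" if "i < n" for i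
      using r_cancel_one'[of "b i" g] g that by auto
    then have "mat_trace (\<rho> g) = (\<Sum>i = 0..<n. of_bool (g = \<one>))"
      unfolding mat_trace_def by (intro sum.cong) (simp_all add: \<rho>_def)
    then show ?thesis by (simp add: n_def)
  qed
  show thesis by (rule that[OF rep tr])
qed

text \<open>
  The character of the regular representation extracts the coefficient of the identity.
\<close>
lemma coefficient_of_one_zero_if_irreducible:
  fixes G (structure) and c :: "'a \<Rightarrow> complex"
  assumes G: "group G" and fin: "finite (carrier G)"
    and irr: "\<And>m \<pi>. irreducible_representation G m \<pi> \<Longrightarrow> (\<Sum>g\<in>carrier G. c g * mat_trace (\<pi> g)) = 0"
  shows "c \<one> = 0"
proof -
  interpret group G by (rule G)
  obtain n \<rho> where \<rho>: "representation G n \<rho>"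
    "\<And>g. g \<in> carrier G \<Longrightarrow> mat_trace (\<rho> g) = (if g = \<one> then of_nat (card (carrier G)) else 0)"
    by (rule regular_representation[OF G fin]) blast
  have "0 = (\<Sum>g\<in>carrier G. c g * mat_trace (\<rho> g))"
    using trace_sum_zero_if_irreducible[OF G irr \<rho>(1)] by simp
  also have "\<dots> = (\<Sum>g\<in>carrier G. if g = \<one> then c g * of_nat (card (carrier G)) else 0)"
    by (rule sum.cong[OF refl]) (simp add: \<rho>(2))
  also have "\<dots> = c \<one> * of_nat (card (carrier G))" using fin by simp
  finally show ?thesis using fin one_closed by auto
qed

text \<open>
  The Hecke operators on irreducible representations separate double cosets.  Equality of the
  operators gives \<open>tr (hecke x * \<pi> (inv y)) = tr (hecke y * \<pi> (inv y))\<close>, which is an equality of two sums of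
  character values, over the elements \<open>h \<otimes> z \<otimes> k \<otimes> inv y\<close> with \<open>z = x\<close> and with \<open>z = y\<close>.  Hence the
  identity occurs equally often in both families, and in the second it occurs for \<open>h = k = \<one>\<close>.
\<close>
lemma same_double_coset_if_hecke_eq:
  fixes G (structure)
  assumes G: "group G" and fin: "finite (carrier G)" and sub: "subgroup H G"
    and x: "x \<in> carrier G" and y: "y \<in> carrier G"
    and eq: "\<And>n \<pi>. irreducible_representation G n \<pi> \<Longrightarrow>
      subgroup_representation.hecke H n \<pi> x = subgroup_representation.hecke H n \<pi> y"
  shows "\<exists>h\<in>H. \<exists>k\<in>H. h \<otimes> x \<otimes> k = y"
proof -
  interpret group G by (rule G)
  interpret H: subgroup H G by (rule sub)
  have finH: "finite H" using H.subset fin by (rule finite_subset)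
  define w where "w z p = fst p \<otimes> z \<otimes> snd p \<otimes> inv y" for z p
  have w: "w z p \<in> carrier G" if "z \<in> carrier G" "p \<in> H \<times> H" for z p
    using that y by (auto simp: w_def)
  define c :: "'a \<Rightarrow> complex"
    where "c g = (\<Sum>p\<in>H \<times> H. of_bool (w x p = g)) - (\<Sum>p\<in>H \<times> H. of_bool (w y p = g))" for g
  have "c \<one> = 0"
  proof (rule coefficient_of_one_zero_if_irreducible[OF G fin])
    fix m \<pi> assume irr: "irreducible_representation G m \<pi>"
    then interpret subgroup_representation G H m \<pi>
      by unfold_locales (simp_all add: fin sub irreducible_representation_def)
    have count: "(\<Sum>g\<in>carrier G. (\<Sum>p\<in>H \<times> H. of_bool (w z p = g)) * mat_trace (\<pi> g)) = mat_trace (hecke z * \<pi> (inv y))"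
      if z: "z \<in> carrier G" for z
    proof -
      have "(\<Sum>g\<in>carrier G. (\<Sum>p\<in>H \<times> H. of_bool (w z p = g)) * mat_trace (\<pi> g))
          = (\<Sum>p\<in>H \<times> H. \<Sum>g\<in>carrier G. if w z p = g then mat_trace (\<pi> g) else 0)"
        unfolding sum_distrib_right by (subst sum.swap) (intro sum.cong, auto)
      also have "\<dots> = (\<Sum>p\<in>H \<times> H. mat_trace (\<pi> (w z p)))"
        by (rule sum.cong[OF refl]) (use w[OF z] fin in \<open>simp add: sum.delta\<close>)
      also have "\<dots> = mat_trace (hecke z * \<pi> (inv y))"
        using trace_hecke_mult[OF z, of "inv y"] y by (simp add: w_def case_prod_unfold)
      finally show ?thesis .
    qed
    show "(\<Sum>g\<in>carrier G. c g * mat_trace (\<pi> g)) = 0"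
      using count[OF x] count[OF y] eq[OF irr]
      by (simp add: c_def left_diff_distrib sum_subtractf)
  qed
  then have "of_nat (card {p \<in> H \<times> H. w x p = \<one>}) = (of_nat (card {p \<in> H \<times> H. w y p = \<one>}) :: complex)"
    using finH by (simp add: c_def of_bool_def sum.If_cases Int_def conj_commute)
  then have "card {p \<in> H \<times> H. w x p = \<one>} = card {p \<in> H \<times> H. w y p = \<one>}" by simp
  moreover have "card {p \<in> H \<times> H. w y p = \<one>} > 0"
  proof -
    have "(\<one>, \<one>) \<in> {p \<in> H \<times> H. w y p = \<one>}" using y by (simp add: w_def)
    moreover have "finite {p \<in> H \<times> H. w y p = \<one>}" using finH by simp
    ultimately show ?thesis by (subst card_gt_0_iff) blast
  qed
  ultimately have "{p \<in> H \<times> H. w x p = \<one>} \<noteq> {}" by (metis card.empty less_irrefl)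
  then obtain h k where hk: "h \<in> H" "k \<in> H" "w x (h, k) = \<one>" by auto
  then have "h \<otimes> x \<otimes> k = y"
    using x y inv_equality[of "h \<otimes> x \<otimes> k" "inv y"] by (simp add: w_def)
  then show ?thesis using hk by blast
qed

section \<open>The criterion for Gelfand pairs\<close>

theorem theorem1:
  fixes G :: "('g, 'b) monoid_scheme" and \<theta> :: "'g \<Rightarrow> 'g" and H :: "'g set"
  assumes "group G" and "finite (carrier G)"
    and "group_involution G \<theta>"
    and "subgroup H G" and "\<theta> ` H = H"
    and "\<forall>x \<in> carrier G. \<exists>g \<in> carrier G.
           g \<otimes>\<^bsub>G\<^esub> inv\<^bsub>G\<^esub> x \<otimes>\<^bsub>G\<^esub> inv\<^bsub>G\<^esub> g = \<theta> x"
  shows "gelfand_pair G H \<longleftrightarrow>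
         (\<forall>x \<in> carrier G. \<exists>h1 \<in> H. \<exists>h2 \<in> H.
            h1 \<otimes>\<^bsub>G\<^esub> inv\<^bsub>G\<^esub> x \<otimes>\<^bsub>G\<^esub> h2 = \<theta> x)"
proof -
  interpret group G by (rule assms(1))
  interpret H: subgroup H G by (rule assms(4))
  have \<theta>_hom: "\<theta> \<in> hom G G" and \<theta>\<theta>: "\<And>x. x \<in> carrier G \<Longrightarrow> \<theta> (\<theta> x) = x"
    using assms(3) by (auto simp: group_involution_def iso_def)
  interpret \<theta>: group_hom G G \<theta> by unfold_locales (rule \<theta>_hom)
  \<comment> \<open>An anti-involution; the conjugacy hypothesis says that it preserves conjugacy classes.\<close>
  define \<sigma> where "\<sigma> x = \<theta> (inv\<^bsub>G\<^esub> x)" for x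
  have \<sigma>_closed: "\<sigma> x \<in> carrier G" if "x \<in> carrier G" for x
    using that by (simp add: \<sigma>_def)
  have \<sigma>_anti: "\<sigma> (x \<otimes>\<^bsub>G\<^esub> y) = \<sigma> y \<otimes>\<^bsub>G\<^esub> \<sigma> x" if "x \<in> carrier G" "y \<in> carrier G" for x y
    using that by (simp add: \<sigma>_def inv_mult_group)
  have \<sigma>\<sigma>: "\<sigma> (\<sigma> x) = x" if "x \<in> carrier G" for x
    using that by (simp add: \<sigma>_def \<theta>\<theta>)
  have \<sigma>_in_H: "\<sigma> h \<in> H" if "h \<in> H" for h
    using that assms(5) by (auto simp: \<sigma>_def)
  have \<sigma>H: "bij_betw \<sigma> H H"
    by (rule bij_betw_byWitness[where f' = \<sigma>]) (auto simp: \<sigma>\<sigma> \<sigma>_in_H)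
  show ?thesis
  proof
    assume gelfand: "gelfand_pair G H"
    show "\<forall>x \<in> carrier G. \<exists>h1 \<in> H. \<exists>h2 \<in> H. h1 \<otimes>\<^bsub>G\<^esub> inv\<^bsub>G\<^esub> x \<otimes>\<^bsub>G\<^esub> h2 = \<theta> x"
    proof
      fix x assume x: "x \<in> carrier G"
      define z where "z = inv\<^bsub>G\<^esub> x"
      have z: "z \<in> carrier G" using x by (simp add: z_def)
      have "\<exists>h\<in>H. \<exists>k\<in>H. h \<otimes>\<^bsub>G\<^esub> z \<otimes>\<^bsub>G\<^esub> k = \<sigma> z"
      proof (rule same_double_coset_if_hecke_eq[OF assms(1,2,4) z \<sigma>_closed[OF z]])
        fix n \<pi> assume irr: "irreducible_representation G n \<pi>"
        then interpret subgroup_representation G H n \<pi>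
          by unfold_locales (simp_all add: assms irreducible_representation_def)
        have tr_comm: "mat_trace (\<pi> (g \<otimes>\<^bsub>G\<^esub> h)) = mat_trace (\<pi> (h \<otimes>\<^bsub>G\<^esub> g))"
          if "g \<in> carrier G" "h \<in> carrier G" for g h
          using that by (simp add: pi_mult mat_trace_mult_comm[of "\<pi> g" n n "\<pi> h"])
        have tr_\<sigma>: "mat_trace (\<pi> (\<sigma> g)) = mat_trace (\<pi> g)" if g: "g \<in> carrier G" for g
        proof -
          obtain a where a: "a \<in> carrier G" "a \<otimes>\<^bsub>G\<^esub> g \<otimes>\<^bsub>G\<^esub> inv\<^bsub>G\<^esub> a = \<sigma> g"
            using assms(6) g inv_closed[OF g] by (metis \<sigma>_def inv_inv)
          have "inv\<^bsub>G\<^esub> a \<otimes>\<^bsub>G\<^esub> (a \<otimes>\<^bsub>G\<^esub> g) = g" using a(1) g by (simp add: m_assoc[symmetric])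
          then show ?thesis using tr_comm[of "a \<otimes>\<^bsub>G\<^esub> g" "inv\<^bsub>G\<^esub> a"] a g by simp
        qed
        \<comment> \<open>Stability of \<open>H\<close> lets \<open>\<sigma>\<close> act on the summation variable as well.\<close>
        have "(\<Sum>h\<in>H. mat_trace (\<pi> (\<sigma> z \<otimes>\<^bsub>G\<^esub> h))) = (\<Sum>h\<in>H. mat_trace (\<pi> (\<sigma> z \<otimes>\<^bsub>G\<^esub> \<sigma> h)))"
          by (rule sum.reindex_bij_betw[OF \<sigma>H, symmetric])
        also have "\<dots> = (\<Sum>h\<in>H. mat_trace (\<pi> (z \<otimes>\<^bsub>G\<^esub> h)))"
        proof (rule sum.cong[OF refl])
          fix h assume "h \<in> H"
          then have h: "h \<in> carrier G" by simp
          have "mat_trace (\<pi> (\<sigma> z \<otimes>\<^bsub>G\<^esub> \<sigma> h)) = mat_trace (\<pi> (\<sigma> (h \<otimes>\<^bsub>G\<^esub> z)))"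
            using h z by (simp add: \<sigma>_anti)
          also have "\<dots> = mat_trace (\<pi> (z \<otimes>\<^bsub>G\<^esub> h))" using h z by (simp add: tr_\<sigma> tr_comm[of h z])
          finally show "mat_trace (\<pi> (\<sigma> z \<otimes>\<^bsub>G\<^esub> \<sigma> h)) = mat_trace (\<pi> (z \<otimes>\<^bsub>G\<^esub> h))" .
        qed
        finally have "mat_trace (hecke z) = mat_trace (hecke (\<sigma> z))"
          using z \<sigma>_closed[OF z] by (simp add: trace_hecke)
        moreover have "subspace_dim n fixed \<le> 1" using gelfand irr by (simp add: gelfand_pair_def)
        ultimately show "hecke z = hecke (\<sigma> z)" using hecke_eq_if_trace_eq z \<sigma>_closed[OF z] by blast
      qed
      moreover have "\<sigma> z = \<theta> x" using x by (simp add: \<sigma>_def z_def)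
      ultimately show "\<exists>h1 \<in> H. \<exists>h2 \<in> H. h1 \<otimes>\<^bsub>G\<^esub> inv\<^bsub>G\<^esub> x \<otimes>\<^bsub>G\<^esub> h2 = \<theta> x"
        by (simp add: z_def)
    qed
  next
    assume dc: "\<forall>x \<in> carrier G. \<exists>h1 \<in> H. \<exists>h2 \<in> H. h1 \<otimes>\<^bsub>G\<^esub> inv\<^bsub>G\<^esub> x \<otimes>\<^bsub>G\<^esub> h2 = \<theta> x"
    have dc\<sigma>: "\<exists>h\<in>H. \<exists>k\<in>H. h \<otimes>\<^bsub>G\<^esub> x \<otimes>\<^bsub>G\<^esub> k = \<sigma> x" if "x \<in> carrier G" for x
      using bspec[OF dc inv_closed[OF that]] that by (simp add: \<sigma>_def)
    show "gelfand_pair G H"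
      unfolding gelfand_pair_def
    proof (intro allI impI)
      fix n \<pi> assume irr: "irreducible_representation G n \<pi>"
      then interpret subgroup_representation G H n \<pi>
        by unfold_locales (simp_all add: assms irreducible_representation_def)
      show "subspace_dim n fixed \<le> 1"
        by (rule fixed_dim_le_1_if_commute[OF irr]) (rule hecke_commute[OF \<sigma>_closed \<sigma>_anti \<sigma>H dc\<sigma>])
    qed
  qed
qed

end
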